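(* Let $\mathcal{Q}_\mathrm{con}^{(L)}=\mathcal{Q}_L \circ \cdots \circ \mathcal{Q}_1$ be an $L$-level concatenated code with parameters $[\![N,K,D]\!]$. Suppose that every $\mathcal{Q}_i$ ($i \in [L]$) is an $[\![n_i,k_i,d_i]\!]$ self-dual CSS code with $k_i\ge 1$, constructed from a binary linear code $\mathcal{D}_i$ with $\mathcal{D}_i^\perp\subsetneq\mathcal{D}_i$, such that, writing $\mathcal{D}_i=\langle \mathcal{D}_i^\perp,\mathbf{h}_1,\dots,\mathbf{h}_{k_i}\rangle$, there is $j\in[k_i]$ with $\mathbf{h}_j\cdot\mathbf{h}_j=1$ (equivalently, $\mathcal{Q}_i$ has a compatible symplectic basis), and that the logical Pauli operators of each $\mathcal{Q}_i$ are defined by a compatible symplectic basis. Then: 1. $\bigotimes_{j=1}^{K} H^{(L)}_{j}$ is transversal at levels $0,\dots,L$ and can be implemented by $\bigotimes_{i=1}^{N} H^{(0)}_{i}$. 2. For any $(a_1,\dots,a_{K}) \in \{1,-1\}^K$, $\bigotimes_{j=1}^{K} \left(S_{j}^{(L)}\right)^{a_j}$ is transversal at levels $0,\dots,L$ and can be implemented by $\bigotimes_{i=1}^{N} \left(S^{(0)}_{i}\right)^{b_i}$ for some $(b_1,\dots,b_{N}) \in \{-1,1\}^{N}$.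
   Context: $[k]=\{1,\dots,k\}$; $\mathbf{a}\cdot\mathbf{b}=\sum_i a_ib_i \pmod 2$ on $\mathbb{Z}_2^n$. Self-dual CSS code: for a binary linear code $\mathcal{D}\subseteq\mathbb{Z}_2^n$ with $\mathcal{D}^\perp\subseteq\mathcal{D}$ and a full-row-rank parity check matrix with rows $\mathbf{g}_1,\dots,\mathbf{g}_r$, it is the stabilizer code whose stabilizer group $S$ is generated by the $X$-type and $Z$-type Pauli operators supported on the supports of the $\mathbf{g}_i$; it encodes $k=n-2r$ logical qubits. A symplectic basis is a set of $k$ pairs $\{(\bar X_j,\bar Z_j)\}_{j\in[k]}$ of Pauli operators commuting with $S$ which together with $S$ and $iI^{\otimes n}$ generate the centralizer $C(S)$ of $S$ in the Pauli group, with $\bar X_j,\bar Z_j$ anticommuting for each $j$ and all other pairs among the $\bar X$'s and $\bar Z$'s commuting. It defines the logical Pauli operators and hence logical gates. Equalities between gates (and "can be implemented by") mean equality of the action on the encoded space, up to global phase. With $H_i$ (Hadamard) and $S_i$ (phase gate $\mathrm{diag}(1,i)$) on physical qubits and $\bar H_j,\bar S_j$ on logical qubits, a symplectic basis is compatible (with multilevel transversal Clifford operations) if (i) $\bigotimes_{j=1}^k\bar H_j=\bigotimes_{i=1}^n H_i$; and (ii) for any $(a_1,\dots,a_k)\in\{-1,1\}^k$ there is $(b_1,\dots,b_n)\in\{-1,1\}^n$ with $\bigotimes_{j=1}^k\bar S_j^{a_j}=\bigotimes_{i=1}^nS_i^{b_i}$. Concatenated code: given $[\![n_i,k_i,d_i]\!]$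 stabilizer codes $\mathcal{Q}_i$, $i\in[L]$, the $L$-level concatenated code $\mathcal{Q}_\mathrm{con}^{(L)}=\mathcal{Q}_L\circ\cdots\circ\mathcal{Q}_1$ has $N=\prod_i n_i$ physical qubits and $K=\prod_i k_i$ logical qubits; $D$ is its distance. Logical qubits at the $l$-th level ($l\in\{0,\dots,L\}$) are indexed by $(j_1,\dots,j_l,i_{l+1},\dots,i_L)\in[k_1]\times\cdots\times[k_l]\times[n_{l+1}]\times\cdots\times[n_L]$, so there are $N^{(l)}=\prod_{i\le l}k_i\prod_{j>l}n_j$ of them; level $0$ qubits are the $N$ physical qubits, and level $L$ qubits are the $K$ logical qubits of $\mathcal{Q}_\mathrm{con}^{(L)}$. For each $l\in[L]$ and each fixed $j_1,\dots,j_{l-1},i_{l+1},\dots,i_L$, the $n_l$ level-$(l-1)$ qubits $(j_1,\dots,j_{l-1},i_l,i_{l+1},\dots,i_L)$, $i_l\in[n_l]$, form a block of $\mathcal{Q}_l$, whose $k_l$ logical qubits are the level-$l$ qubits $(j_1,\dots,j_{l-1},j_l,i_{l+1},\dots,i_L)$, $j_l\in[k_l]$. $H^{(l)}_j$ and $S^{(l)}_j$ are the Hadamard and phase gates on the $j$-th level-$l$ qubit (in some enumeration). A gate $U^{(l)}$ on one block of $\mathcal{Q}_\mathrm{con}^{(L)}$, acting on the $N^{(l)}$ level-$l$ qubits, is transversal at the $m$-th level if $U^{(l)}=\bigotimes_{i=1}^{N^{(m)}}G_i^{(m)}$ where $G_i^{(m)}$ is a single-qubit gate on the $i$-th level-$m$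 qubit. *)

theory Defs
  imports
    Complex_Main
    "HOL-Library.Z2"
    "HOL-Library.FuncSet"
    "HOL-Library.Function_Algebras"
    "HOL-Algebra.Generated_Groups"
begin

section \<open>Binary vectors and binary linear codes\<close>

text \<open>
  The space \<open>Z\<^sub>2\<^sup>Q\<close>, for a finite index set \<open>Q\<close>, is the set of functions into the field
  \<^typ>\<open>bit\<close> that vanish outside \<open>Q\<close>. These functions serve both as codewords and as labels of
  the computational basis of the Hilbert space of the qubits in \<open>Q\<close>.
\<close>

definition bits :: "'q set \<Rightarrow> ('q \<Rightarrow> bit) set" where
  "bits Q = {x. \<forall>q. q \<notin> Q \<longrightarrow> x q = 0}"

definition bit_scale :: "bit \<Rightarrow> ('q \<Rightarrow> bit) \<Rightarrow> 'q \<Rightarrow> bit" where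
  "bit_scale c x = (\<lambda>q. c * x q)"

global_interpretation bitvec: vector_space "bit_scale :: bit \<Rightarrow> ('q \<Rightarrow> bit) \<Rightarrow> 'q \<Rightarrow> bit"
  by unfold_locales (auto simp: bit_scale_def fun_eq_iff algebra_simps)

definition dot :: "'q set \<Rightarrow> ('q \<Rightarrow> bit) \<Rightarrow> ('q \<Rightarrow> bit) \<Rightarrow> bit" where
  "dot Q x y = (\<Sum>q\<in>Q. x q * y q)"

definition linear_code :: "'q set \<Rightarrow> ('q \<Rightarrow> bit) set \<Rightarrow> bool" where
  "linear_code Q D \<longleftrightarrow> D \<subseteq> bits Q \<and> bitvec.subspace D"

definition dual_code :: "'q set \<Rightarrow> ('q \<Rightarrow> bit) set \<Rightarrow> ('q \<Rightarrow> bit) set" where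
  "dual_code Q D = {x \<in> bits Q. \<forall>y\<in>D. dot Q x y = 0}"

definition parity_check_rows ::
  "'q set \<Rightarrow> ('q \<Rightarrow> bit) set \<Rightarrow> nat \<Rightarrow> (nat \<Rightarrow> 'q \<Rightarrow> bit) \<Rightarrow> bool" where
  "parity_check_rows Q D r g \<longleftrightarrow>
     g ` {1..r} \<subseteq> bits Q \<and> inj_on g {1..r} \<and> \<not> bitvec.dependent (g ` {1..r}) \<and>
     D = {x \<in> bits Q. \<forall>i\<in>{1..r}. dot Q (g i) x = 0}"


section \<open>Operators on qubits\<close>

text \<open>
  An operator from the qubits in \<open>P\<close> to the qubits in \<open>Q\<close> is given by its matrix in the
  computational bases, with rows indexed by \<open>bits Q\<close> and columns indexed by \<open>bits P\<close>.
\<close>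

type_synonym gate = "bit \<Rightarrow> bit \<Rightarrow> complex"
type_synonym ('q, 'p) op = "('q \<Rightarrow> bit) \<Rightarrow> ('p \<Rightarrow> bit) \<Rightarrow> complex"

definition gate_I :: gate where
  "gate_I a b = (if a = b then 1 else 0)"

definition gate_X :: gate where
  "gate_X a b = (if a \<noteq> b then 1 else 0)"

definition gate_Y :: gate where
  "gate_Y a b = (if a = b then 0 else if a = 0 then - \<i> else \<i>)"

definition gate_Z :: gate where
  "gate_Z a b = (if a \<noteq> b then 0 else if a = 0 then 1 else - 1)"

definition gate_H :: gate where
  "gate_H a b = complex_of_real (1 / sqrt 2) * (if a = 1 \<and> b = 1 then - 1 else 1)"

text \<open>The integer power \<open>diag(1, i)\<^sup>s\<close> of the phase gate.\<close>

definition gate_S_power :: "int \<Rightarrow> gate" where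
  "gate_S_power s a b = (if a \<noteq> b then 0 else if a = 0 then 1 else \<i> powi s)"

definition unitary_gate :: "gate \<Rightarrow> bool" where
  "unitary_gate G \<longleftrightarrow> (\<forall>a b. (\<Sum>c\<in>UNIV. cnj (G c a) * G c b) = (if a = b then 1 else 0))"

definition op_mult :: "'p set \<Rightarrow> ('q, 'p) op \<Rightarrow> ('p, 's) op \<Rightarrow> ('q, 's) op" where
  "op_mult P A B = (\<lambda>x z. \<Sum>y\<in>bits P. A x y * B y z)"

definition op_apply :: "'p set \<Rightarrow> ('q, 'p) op \<Rightarrow> (('p \<Rightarrow> bit) \<Rightarrow> complex) \<Rightarrow> ('q \<Rightarrow> bit) \<Rightarrow> complex" where
  "op_apply P A \<psi> = (\<lambda>x. \<Sum>y\<in>bits P. A x y * \<psi> y)"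

definition states :: "'q set \<Rightarrow> (('q \<Rightarrow> bit) \<Rightarrow> complex) set" where
  "states Q = {\<psi>. \<forall>x. x \<notin> bits Q \<longrightarrow> \<psi> x = 0}"

definition op_eq :: "'q set \<Rightarrow> 'p set \<Rightarrow> ('q, 'p) op \<Rightarrow> ('q, 'p) op \<Rightarrow> bool" where
  "op_eq Q P A B \<longleftrightarrow> (\<forall>x\<in>bits Q. \<forall>y\<in>bits P. A x y = B x y)"

definition op_eq_phase :: "'q set \<Rightarrow> 'p set \<Rightarrow> ('q, 'p) op \<Rightarrow> ('q, 'p) op \<Rightarrow> bool" where
  "op_eq_phase Q P A B \<longleftrightarrow> (\<exists>c. cmod c = 1 \<and> op_eq Q P A (\<lambda>x y. c * B x y))"

definition tensor :: "'q set \<Rightarrow> ('q \<Rightarrow> gate) \<Rightarrow> ('q, 'q) op" where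
  "tensor Q G = (\<lambda>x y. if x \<in> bits Q \<and> y \<in> bits Q then \<Prod>q\<in>Q. G q (x q) (y q) else 0)"

definition gate_on :: "'q set \<Rightarrow> 'q \<Rightarrow> gate \<Rightarrow> ('q, 'q) op" where
  "gate_on Q q G = tensor Q (\<lambda>p. if p = q then G else gate_I)"


section \<open>The Pauli group and stabilizer codes\<close>

definition pauli :: "'q set \<Rightarrow> complex \<Rightarrow> ('q \<Rightarrow> gate) \<Rightarrow> ('q, 'q) op" where
  "pauli Q c P = (\<lambda>x y. c * tensor Q P x y)"

definition pauli_group :: "'q set \<Rightarrow> ('q, 'q) op monoid" where
  "pauli_group Q =
     \<lparr>carrier = {pauli Q c P | c P. c \<in> {1, - 1, \<i>, - \<i>} \<and>
                  (\<forall>q\<in>Q. P q \<in> {gate_I, gate_X, gate_Y, gate_Z})},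
      monoid.mult = op_mult Q, one = tensor Q (\<lambda>_. gate_I)\<rparr>"

definition phase_i :: "'q set \<Rightarrow> ('q, 'q) op" where
  "phase_i Q = pauli Q \<i> (\<lambda>_. gate_I)"

definition centralizer :: "'q set \<Rightarrow> ('q, 'q) op set \<Rightarrow> ('q, 'q) op set" where
  "centralizer Q S = {A \<in> carrier (pauli_group Q). \<forall>B\<in>S. op_mult Q A B = op_mult Q B A}"

definition code_space :: "'q set \<Rightarrow> ('q, 'q) op set \<Rightarrow> (('q \<Rightarrow> bit) \<Rightarrow> complex) set" where
  "code_space Q S = {\<psi> \<in> states Q. \<forall>A\<in>S. op_apply Q A \<psi> = \<psi>}"

text \<open>
  The distance of the code with stabilizer group \<open>S\<close>: the minimum weight of a Pauli operator that
  commutes with \<open>S\<close> and does not belong to \<open>S\<close> up to phase.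
\<close>

definition code_distance :: "'q set \<Rightarrow> ('q, 'q) op set \<Rightarrow> nat" where
  "code_distance Q S =
     (LEAST w. \<exists>c P. c \<in> {1, - 1, \<i>, - \<i>} \<and>
        (\<forall>q\<in>Q. P q \<in> {gate_I, gate_X, gate_Y, gate_Z}) \<and>
        pauli Q c P \<in> centralizer Q S - generate (pauli_group Q) (insert (phase_i Q) S) \<and>
        w = card {q \<in> Q. P q \<noteq> gate_I})"

definition X_type :: "'q set \<Rightarrow> ('q \<Rightarrow> bit) \<Rightarrow> ('q, 'q) op" where
  "X_type Q g = tensor Q (\<lambda>q. if g q = 1 then gate_X else gate_I)"

definition Z_type :: "'q set \<Rightarrow> ('q \<Rightarrow> bit) \<Rightarrow> ('q, 'q) op" where
  "Z_type Q g = tensor Q (\<lambda>q. if g q = 1 then gate_Z else gate_I)"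

definition css_stabilizer :: "nat \<Rightarrow> nat \<Rightarrow> (nat \<Rightarrow> nat \<Rightarrow> bit) \<Rightarrow> (nat, nat) op set" where
  "css_stabilizer n r g =
     generate (pauli_group {1..n}) (X_type {1..n} ` g ` {1..r} \<union> Z_type {1..n} ` g ` {1..r})"

text \<open>
  The \<open>[[n, k, d]]\<close> self-dual CSS code obtained from the binary linear code \<open>D\<close> with
  parity check rows \<open>g 1, \<dots>, g r\<close>.
\<close>

definition self_dual_css_code ::
  "nat \<Rightarrow> nat \<Rightarrow> nat \<Rightarrow> (nat \<Rightarrow> bit) set \<Rightarrow> nat \<Rightarrow> (nat \<Rightarrow> nat \<Rightarrow> bit) \<Rightarrow> bool" where
  "self_dual_css_code n k d D r g \<longleftrightarrow>
     linear_code {1..n} D \<and> dual_code {1..n} D \<subseteq> D \<and> parity_check_rows {1..n} D r g \<and>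
     n = k + 2 * r \<and> d = code_distance {1..n} (css_stabilizer n r g)"


section \<open>Symplectic bases and logical gates\<close>

definition hermitian_op :: "('q, 'q) op \<Rightarrow> bool" where
  "hermitian_op A \<longleftrightarrow> (\<forall>x y. A y x = cnj (A x y))"

text \<open>
  Hermiticity excludes phases \<open>\<plusminus>i\<close>: an operator with square \<open>- 1\<close> cannot serve as a logical
  Pauli \<open>X\<close> or \<open>Z\<close>.
\<close>

definition symplectic_basis ::
  "nat \<Rightarrow> nat \<Rightarrow> (nat, nat) op set \<Rightarrow> (nat \<Rightarrow> (nat, nat) op) \<Rightarrow> (nat \<Rightarrow> (nat, nat) op) \<Rightarrow> bool" where
  "symplectic_basis n k S XB ZB \<longleftrightarrow>
     (\<forall>j\<in>{1..k}. XB j \<in> centralizer {1..n} S \<and> ZB j \<in> centralizer {1..n} S \<and>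
                 hermitian_op (XB j) \<and> hermitian_op (ZB j)) \<and>
     generate (pauli_group {1..n}) (insert (phase_i {1..n}) (S \<union> XB ` {1..k} \<union> ZB ` {1..k}))
       = centralizer {1..n} S \<and>
     (\<forall>j\<in>{1..k}. op_mult {1..n} (XB j) (ZB j) = (\<lambda>x y. - op_mult {1..n} (ZB j) (XB j) x y)) \<and>
     (\<forall>i\<in>{1..k}. \<forall>j\<in>{1..k}.
        op_mult {1..n} (XB i) (XB j) = op_mult {1..n} (XB j) (XB i) \<and>
        op_mult {1..n} (ZB i) (ZB j) = op_mult {1..n} (ZB j) (ZB i) \<and>
        (i \<noteq> j \<longrightarrow> op_mult {1..n} (XB i) (ZB j) = op_mult {1..n} (ZB j) (XB i)))"

text \<open>
  An encoding identifies \<open>k\<close> logical qubits with the code space: it is an isometry onto the code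
  space that carries the Pauli operators of the \<open>j\<close>-th logical qubit to \<open>XB j\<close> and \<open>ZB j\<close>. For a
  symplectic basis it is unique up to a global phase.
\<close>

definition is_encoding ::
  "nat \<Rightarrow> nat \<Rightarrow> (nat, nat) op set \<Rightarrow> (nat \<Rightarrow> (nat, nat) op) \<Rightarrow> (nat \<Rightarrow> (nat, nat) op)
     \<Rightarrow> (nat, nat) op \<Rightarrow> bool" where
  "is_encoding n k S XB ZB V \<longleftrightarrow>
     op_eq {1..k} {1..k} (\<lambda>y z. \<Sum>x\<in>bits {1..n}. cnj (V x y) * V x z)
       (\<lambda>y z. if y = z then 1 else 0) \<and>
     op_apply {1..k} V ` states {1..k} = code_space {1..n} S \<and>
     (\<forall>j\<in>{1..k}.
        op_eq {1..n} {1..k} (op_mult {1..n} (XB j) V) (op_mult {1..k} V (gate_on {1..k} j gate_X)) \<and>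
        op_eq {1..n} {1..k} (op_mult {1..n} (ZB j) V) (op_mult {1..k} V (gate_on {1..k} j gate_Z)))"

text \<open>
  The physical operator \<open>A\<close> and the logical operator \<open>U\<close> act in the same way on the encoded space,
  up to a global phase. The encoding \<open>V\<close> maps the qubits in \<open>P\<close> into the qubits in \<open>Q\<close>.
\<close>

definition acts_as ::
  "'q set \<Rightarrow> 'p set \<Rightarrow> ('q, 'p) op \<Rightarrow> ('q, 'q) op \<Rightarrow> ('p, 'p) op \<Rightarrow> bool" where
  "acts_as Q P V A U \<longleftrightarrow> op_eq_phase Q P (op_mult Q A V) (op_mult P V U)"

definition compatible_basis ::
  "nat \<Rightarrow> nat \<Rightarrow> (nat, nat) op set \<Rightarrow> (nat \<Rightarrow> (nat, nat) op) \<Rightarrow> (nat \<Rightarrow> (nat, nat) op) \<Rightarrow> bool" where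
  "compatible_basis n k S XB ZB \<longleftrightarrow>
     symplectic_basis n k S XB ZB \<and>
     (\<forall>V. is_encoding n k S XB ZB V \<longrightarrow>
        acts_as {1..n} {1..k} V (tensor {1..n} (\<lambda>_. gate_H)) (tensor {1..k} (\<lambda>_. gate_H)) \<and>
        (\<forall>a :: nat \<Rightarrow> int. (\<forall>j\<in>{1..k}. a j \<in> {- 1, 1}) \<longrightarrow>
           (\<exists>b :: nat \<Rightarrow> int. (\<forall>i\<in>{1..n}. b i \<in> {- 1, 1}) \<and>
              acts_as {1..n} {1..k} V (tensor {1..n} (\<lambda>i. gate_S_power (b i)))
                (tensor {1..k} (\<lambda>j. gate_S_power (a j))))))"


section \<open>Concatenated codes\<close>

text \<open>
  A level-\<open>l\<close> qubit \<open>(j\<^sub>1, \<dots>, j\<^sub>l, i\<^sub>l\<^sub>+\<^sub>1, \<dots>, i\<^sub>L)\<close> is an extensional function on \<open>{1..L}\<close>. The blocks of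
  the \<open>l\<close>-th code are indexed by the tuples without the \<open>l\<close>-th coordinate, and \<open>\<beta>(l := i)\<close> runs
  over the level-\<open>(l - 1)\<close> qubits of the block \<open>\<beta>\<close> for \<open>i \<in> {1..n l}\<close> and over its level-\<open>l\<close>
  qubits for \<open>i \<in> {1..k l}\<close>.
\<close>

definition level_qubits ::
  "nat \<Rightarrow> (nat \<Rightarrow> nat) \<Rightarrow> (nat \<Rightarrow> nat) \<Rightarrow> nat \<Rightarrow> (nat \<Rightarrow> nat) set" where
  "level_qubits L n k l = (\<Pi>\<^sub>E t\<in>{1..L}. if t \<le> l then {1..k t} else {1..n t})"

definition level_blocks ::
  "nat \<Rightarrow> (nat \<Rightarrow> nat) \<Rightarrow> (nat \<Rightarrow> nat) \<Rightarrow> nat \<Rightarrow> (nat \<Rightarrow> nat) set" where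
  "level_blocks L n k l = (\<Pi>\<^sub>E t\<in>{1..L} - {l}. if t < l then {1..k t} else {1..n t})"

definition block_bits ::
  "nat \<Rightarrow> nat \<Rightarrow> (nat \<Rightarrow> nat) \<Rightarrow> ((nat \<Rightarrow> nat) \<Rightarrow> bit) \<Rightarrow> nat \<Rightarrow> bit" where
  "block_bits l m \<beta> x = (\<lambda>i. if i \<in> {1..m} then x (\<beta>(l := i)) else 0)"

text \<open>The tensor product of the encodings \<open>V l\<close> of all blocks of the \<open>l\<close>-th code.\<close>

definition level_encoding ::
  "nat \<Rightarrow> (nat \<Rightarrow> nat) \<Rightarrow> (nat \<Rightarrow> nat) \<Rightarrow> (nat \<Rightarrow> (nat, nat) op) \<Rightarrow> nat
     \<Rightarrow> (nat \<Rightarrow> nat, nat \<Rightarrow> nat) op" where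
  "level_encoding L n k V l =
     (\<lambda>x y. \<Prod>\<beta>\<in>level_blocks L n k l. V l (block_bits l (n l) \<beta> x) (block_bits l (k l) \<beta> y))"

text \<open>
  For \<open>m \<le> l\<close>, the encoding of the level-\<open>l\<close> qubits into the level-\<open>m\<close> qubits, i.e. the product
  of the level encodings \<open>m + 1, \<dots>, l\<close>. For \<open>m > l\<close> the value is irrelevant.
\<close>

primrec concat_encoding ::
  "nat \<Rightarrow> (nat \<Rightarrow> nat) \<Rightarrow> (nat \<Rightarrow> nat) \<Rightarrow> (nat \<Rightarrow> (nat, nat) op) \<Rightarrow> nat \<Rightarrow> nat
     \<Rightarrow> (nat \<Rightarrow> nat, nat \<Rightarrow> nat) op" where
  "concat_encoding L n k V m 0 = (\<lambda>x y. if x = y then 1 else 0)"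
| "concat_encoding L n k V m (Suc l) =
     (if Suc l \<le> m then (\<lambda>x y. if x = y then 1 else 0)
      else op_mult (level_qubits L n k l) (concat_encoding L n k V m l)
             (level_encoding L n k V (Suc l)))"

definition concat_stabilizer ::
  "nat \<Rightarrow> (nat \<Rightarrow> nat) \<Rightarrow> (nat \<Rightarrow> nat) \<Rightarrow> (nat \<Rightarrow> (nat, nat) op)
     \<Rightarrow> (nat \<Rightarrow> nat, nat \<Rightarrow> nat) op set" where
  "concat_stabilizer L n k V =
     {A \<in> carrier (pauli_group (level_qubits L n k 0)).
        op_eq (level_qubits L n k 0) (level_qubits L n k L)
          (op_mult (level_qubits L n k 0) A (concat_encoding L n k V 0 L))
          (concat_encoding L n k V 0 L)}"

definition concat_parameters ::
  "nat \<Rightarrow> (nat \<Rightarrow> nat) \<Rightarrow> (nat \<Rightarrow> nat) \<Rightarrow> (nat \<Rightarrow> (nat, nat) op) \<Rightarrow> nat \<Rightarrow> nat \<Rightarrow> nat \<Rightarrow> bool" where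
  "concat_parameters L n k V N K Dist \<longleftrightarrow>
     N = (\<Prod>i\<in>{1..L}. n i) \<and> K = (\<Prod>i\<in>{1..L}. k i) \<and>
     Dist = code_distance (level_qubits L n k 0) (concat_stabilizer L n k V)"

text \<open>The operator \<open>A\<close> on the level-\<open>m\<close> qubits implements the operator \<open>U\<close> on the level-\<open>l\<close> qubits.\<close>

definition implements ::
  "nat \<Rightarrow> (nat \<Rightarrow> nat) \<Rightarrow> (nat \<Rightarrow> nat) \<Rightarrow> (nat \<Rightarrow> (nat, nat) op) \<Rightarrow> nat \<Rightarrow> nat
     \<Rightarrow> (nat \<Rightarrow> nat, nat \<Rightarrow> nat) op \<Rightarrow> (nat \<Rightarrow> nat, nat \<Rightarrow> nat) op \<Rightarrow> bool" where
  "implements L n k V m l A U \<longleftrightarrow> m \<le> l \<and> l \<le> L \<and>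
     acts_as (level_qubits L n k m) (level_qubits L n k l) (concat_encoding L n k V m l) A U"

definition transversal_at ::
  "nat \<Rightarrow> (nat \<Rightarrow> nat) \<Rightarrow> (nat \<Rightarrow> nat) \<Rightarrow> (nat \<Rightarrow> (nat, nat) op) \<Rightarrow> nat \<Rightarrow> nat
     \<Rightarrow> (nat \<Rightarrow> nat, nat \<Rightarrow> nat) op \<Rightarrow> bool" where
  "transversal_at L n k V l m U \<longleftrightarrow>
     (\<exists>G. (\<forall>q\<in>level_qubits L n k m. unitary_gate (G q)) \<and>
          implements L n k V m l (tensor (level_qubits L n k m) G) U)"

definition H_all ::
  "nat \<Rightarrow> (nat \<Rightarrow> nat) \<Rightarrow> (nat \<Rightarrow> nat) \<Rightarrow> nat \<Rightarrow> (nat \<Rightarrow> nat, nat \<Rightarrow> nat) op" where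
  "H_all L n k l = tensor (level_qubits L n k l) (\<lambda>_. gate_H)"

definition S_all ::
  "nat \<Rightarrow> (nat \<Rightarrow> nat) \<Rightarrow> (nat \<Rightarrow> nat) \<Rightarrow> nat \<Rightarrow> ((nat \<Rightarrow> nat) \<Rightarrow> int)
     \<Rightarrow> (nat \<Rightarrow> nat, nat \<Rightarrow> nat) op" where
  "S_all L n k l a = tensor (level_qubits L n k l) (\<lambda>q. gate_S_power (a q))"

end

theory Submission
  imports Defs
begin

text \<open>
  An encoding of a whole level is the tensor product of the encodings of its blocks, so the matrix
  entries of both sides of the compatibility condition factor over the blocks; multiplying the
  conditions of the blocks shows that transversal Hadamard and phase gates at level \<open>l\<close> are
  implemented by gates of the same kind at level \<open>l - 1\<close>. Composing these relations along
  \<open>L, L - 1, \<dots>, m\<close> gives the theorem.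
\<close>

section \<open>Finiteness of bit vectors and calculus of the relation \<open>acts_as\<close>\<close>

lemma UNIV_bit: "(UNIV :: bit set) = {0, 1}"
  using bit_not_zero_iff by auto

lemma finite_bits:
  assumes "finite Q"
  shows "finite (bits Q)"
proof -
  have "bits Q = {x. \<forall>q. (q \<in> Q \<longrightarrow> x q \<in> UNIV) \<and> (q \<notin> Q \<longrightarrow> x q = 0)}"
    by (auto simp: bits_def)
  then show ?thesis
    using finite_set_of_finite_funs[OF assms, of "UNIV :: bit set" 0]
    by (simp add: UNIV_bit)
qed

lemma op_mult_assoc:
  "op_mult P A (op_mult R B C) = op_mult R (op_mult P A B) C"
proof (intro ext)
  fix x z
  have "(\<Sum>p\<in>bits P. A x p * (\<Sum>q\<in>bits R. B p q * C q z)) =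
        (\<Sum>p\<in>bits P. \<Sum>q\<in>bits R. A x p * B p q * C q z)"
    by (simp add: sum_distrib_left mult.assoc)
  also have "\<dots> = (\<Sum>q\<in>bits R. (\<Sum>p\<in>bits P. A x p * B p q) * C q z)"
    by (subst sum.swap) (simp add: sum_distrib_right)
  finally show "op_mult P A (op_mult R B C) x z = op_mult R (op_mult P A B) C x z"
    by (simp add: op_mult_def)
qed

text \<open>Moving \<open>A\<close> through \<open>V\<close> turns it into \<open>U\<close>, and
  moving \<open>U\<close> through \<open>W\<close> turns it into \<open>T\<close>; the two global
  phases multiply to one of modulus 1.\<close>

lemma acts_as_compose:
  assumes "acts_as Q P V A U" and "acts_as P R W U T"
  shows "acts_as Q R (op_mult P V W) A T"
proof -
  obtain c where c: "cmod c = 1"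
    "\<And>x y. x \<in> bits Q \<Longrightarrow> y \<in> bits P \<Longrightarrow> op_mult Q A V x y = c * op_mult P V U x y"
    using assms(1) by (auto simp: acts_as_def op_eq_phase_def op_eq_def)
  obtain c' where c': "cmod c' = 1"
    "\<And>x y. x \<in> bits P \<Longrightarrow> y \<in> bits R \<Longrightarrow> op_mult P U W x y = c' * op_mult R W T x y"
    using assms(2) by (auto simp: acts_as_def op_eq_phase_def op_eq_def)
  have "op_mult Q A (op_mult P V W) x z = (c * c') * op_mult R (op_mult P V W) T x z"
    if x: "x \<in> bits Q" and z: "z \<in> bits R" for x z
  proof -
    have "op_mult Q A (op_mult P V W) x z = (\<Sum>y\<in>bits P. op_mult Q A V x y * W y z)"
      by (simp add: op_mult_assoc) (simp add: op_mult_def)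
    also have "\<dots> = c * op_mult P (op_mult P V U) W x z"
      by (simp add: c(2)[OF x] op_mult_def[of P "op_mult P V U"] sum_distrib_left mult.assoc)
    also have "\<dots> = c * (\<Sum>y\<in>bits P. V x y * op_mult P U W y z)"
      by (simp flip: op_mult_assoc) (simp add: op_mult_def)
    also have "\<dots> = (c * c') * op_mult P V (op_mult R W T) x z"
      by (simp add: c'(2)[OF _ z] op_mult_def[of P V] sum_distrib_left mult_ac)
    finally show ?thesis by (simp add: op_mult_assoc)
  qed
  moreover have "cmod (c * c') = 1" by (simp add: c c' norm_mult)
  ultimately show ?thesis
    unfolding acts_as_def op_eq_phase_def op_eq_def by blast
qed

lemma acts_as_identity:
  assumes "finite Q"
  shows "acts_as Q Q (\<lambda>x y. if x = y then 1 else 0) A A"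
proof -
  have "op_mult Q A (\<lambda>x y. if x = y then 1 else 0) x y =
        op_mult Q (\<lambda>x y. if x = y then 1 else 0) A x y"
    if "x \<in> bits Q" "y \<in> bits Q" for x y
    using that finite_bits[OF assms]
    by (simp add: op_mult_def if_distrib[of "\<lambda>u. _ * u"] if_distrib[of "\<lambda>u. u * _"] cong: if_cong)
  then show ?thesis
    unfolding acts_as_def op_eq_phase_def op_eq_def by (intro exI[of _ 1]) auto
qed

section \<open>Splitting tuples of coordinates into blocks\<close>

text \<open>The ranges \<open>F\<close> stay abstract so that one set of blocks serves both sides of
  an encoding: the physical and the logical qubits of level \<open>l\<close> are
  \<open>block_qubits\<close> for the same \<open>F\<close>, with \<open>m\<close> equal to
  \<open>n l\<close> or \<open>k l\<close>.\<close>

definition block_family :: "nat set \<Rightarrow> nat \<Rightarrow> (nat \<Rightarrow> nat set) \<Rightarrow> (nat \<Rightarrow> nat) set" where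
  "block_family T l F = (\<Pi>\<^sub>E t\<in>T - {l}. F t)"

definition block_qubits :: "nat set \<Rightarrow> nat \<Rightarrow> (nat \<Rightarrow> nat set) \<Rightarrow> nat \<Rightarrow> (nat \<Rightarrow> nat) set" where
  "block_qubits T l F m = (\<Pi>\<^sub>E t\<in>T. if t = l then {1..m} else F t)"

lemma block_family_undefined: "\<beta> \<in> block_family T l F \<Longrightarrow> \<beta> l = undefined"
  by (auto simp: block_family_def PiE_def extensional_def)

lemma block_qubits_upd:
  assumes "l \<in> T" "\<beta> \<in> block_family T l F" "i \<in> {1..m}"
  shows "\<beta>(l := i) \<in> block_qubits T l F m"
  using assms by (auto simp: block_family_def block_qubits_def PiE_def Pi_def extensional_def)

lemma block_qubits_restrict:
  assumes "l \<in> T" "q \<in> block_qubits T l F m"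
  shows "q(l := undefined) \<in> block_family T l F" "q l \<in> {1..m}"
proof -
  have q: "q t \<in> (if t = l then {1..m} else F t)" if "t \<in> T" for t
    using assms(2) that unfolding block_qubits_def by (rule PiE_mem)
  show "q l \<in> {1..m}" using q[OF assms(1)] by simp
  have "q t = undefined" if "t \<notin> T" for t
    using assms(2) that unfolding block_qubits_def by (rule PiE_arb)
  moreover have "q t \<in> F t" if "t \<in> T" "t \<noteq> l" for t
    using q[OF that(1)] that(2) by simp
  ultimately show "q(l := undefined) \<in> block_family T l F"
    by (auto simp: block_family_def PiE_def Pi_def extensional_def)
qed

text \<open>A block carries \<open>undefined\<close> at coordinate \<open>l\<close> by
  extensionality, so resetting that coordinate of a qubit recovers its block, and the old value is
  the position inside it.\<close>

lemma bij_block_qubits: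
  assumes "l \<in> T"
  shows "bij_betw (\<lambda>(\<beta>, i). \<beta>(l := i)) (block_family T l F \<times> {1..m}) (block_qubits T l F m)"
  by (rule bij_betw_byWitness[where f' = "\<lambda>q. (q(l := undefined), q l)"])
    (use block_qubits_upd[OF assms] block_qubits_restrict[OF assms] in
      \<open>auto simp: block_family_undefined fun_upd_idem\<close>)

lemma prod_block_qubits:
  assumes "l \<in> T"
  shows "(\<Prod>q\<in>block_qubits T l F m. f q) = (\<Prod>\<beta>\<in>block_family T l F. \<Prod>i\<in>{1..m}. f (\<beta>(l := i)))"
  by (subst prod.reindex_bij_betw[OF bij_block_qubits[OF assms], symmetric])
    (simp add: prod.cartesian_product case_prod_unfold)

section \<open>Factorisation of bit vectors, sums and operators over blocks\<close>

lemma block_bits_in_bits: "block_bits l m \<beta> x \<in> bits {1..m}"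
  by (simp add: block_bits_def bits_def)

text \<open>This is the tensor decomposition of the computational basis: a basis label of the whole
  level amounts to an independent choice of a basis label for every block.\<close>

lemma bij_block_bits:
  assumes "l \<in> T"
  shows "bij_betw (\<lambda>x. \<lambda>\<beta>\<in>block_family T l F. block_bits l m \<beta> x)
           (bits (block_qubits T l F m)) (block_family T l F \<rightarrow>\<^sub>E bits {1..m})"
\<comment> \<open>The inverse glues the block vectors \<open>u\<close>: the bit at \<open>q\<close>
  is read from the vector of the block of \<open>q\<close>, and the default 0 outside the qubits is
  what \<open>bits\<close> demands.\<close>
proof (rule bij_betw_byWitness[where f' =
      "\<lambda>u q. if q \<in> block_qubits T l F m then u (q(l := undefined)) (q l) else 0"])
  note upd = block_qubits_upd[OF assms] and restr = block_qubits_restrict[OF assms]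
  show "\<forall>x\<in>bits (block_qubits T l F m).
      (\<lambda>q. if q \<in> block_qubits T l F m
           then (\<lambda>\<beta>\<in>block_family T l F. block_bits l m \<beta> x) (q(l := undefined)) (q l) else 0) = x"
  proof (intro ballI ext)
    fix x q assume x: "x \<in> bits (block_qubits T l F m)"
    show "(if q \<in> block_qubits T l F m
           then (\<lambda>\<beta>\<in>block_family T l F. block_bits l m \<beta> x) (q(l := undefined)) (q l) else 0) = x q"
    proof (cases "q \<in> block_qubits T l F m")
      case True
      with restr[OF True] show ?thesis by (simp add: block_bits_def)
    next
      case False
      with x show ?thesis by (simp add: bits_def)
    qed
  qed
  show "\<forall>u\<in>block_family T l F \<rightarrow>\<^sub>E bits {1..m}.
      (\<lambda>\<beta>\<in>block_family T l F. block_bits l m \<beta>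
         (\<lambda>q. if q \<in> block_qubits T l F m then u (q(l := undefined)) (q l) else 0)) = u"
  proof (intro ballI ext)
    fix u \<beta> i assume u: "u \<in> block_family T l F \<rightarrow>\<^sub>E bits {1..m}"
    show "(\<lambda>\<beta>\<in>block_family T l F. block_bits l m \<beta>
         (\<lambda>q. if q \<in> block_qubits T l F m then u (q(l := undefined)) (q l) else 0)) \<beta> i = u \<beta> i"
    proof (cases "\<beta> \<in> block_family T l F")
      case True
      then have "u \<beta> \<in> bits {1..m}" using u by (rule PiE_mem[rotated])
      then have "u \<beta> i = 0" if "i \<notin> {1..m}" using that by (auto simp: bits_def)
      moreover have "\<beta>(l := undefined) = \<beta>"
        using block_family_undefined[OF True] by (simp add: fun_upd_idem)
      ultimately show ?thesis
        using upd[OF True, of i m] True by (simp add: block_bits_def)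
    next
      case False
      with PiE_arb[OF u False] show ?thesis by simp
    qed
  qed
  show "(\<lambda>x. \<lambda>\<beta>\<in>block_family T l F. block_bits l m \<beta> x) ` bits (block_qubits T l F m)
      \<subseteq> block_family T l F \<rightarrow>\<^sub>E bits {1..m}"
    by (intro image_subsetI restrict_PiE_iff[THEN iffD2] ballI block_bits_in_bits)
  show "(\<lambda>u q. if q \<in> block_qubits T l F m then u (q(l := undefined)) (q l) else 0) `
      (block_family T l F \<rightarrow>\<^sub>E bits {1..m}) \<subseteq> bits (block_qubits T l F m)"
    by (intro image_subsetI) (simp add: bits_def)
qed

text \<open>By distributivity a product of sums is a sum over choice functions, and
  \<open>bij_block_bits\<close> turns the choice functions into bit vectors of the level.\<close>

lemma sum_bits_blocks:
  fixes f :: "(nat \<Rightarrow> nat) \<Rightarrow> (nat \<Rightarrow> bit) \<Rightarrow> complex"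
  assumes "l \<in> T" "finite (block_family T l F)"
  shows "(\<Sum>x\<in>bits (block_qubits T l F m). \<Prod>\<beta>\<in>block_family T l F. f \<beta> (block_bits l m \<beta> x)) =
         (\<Prod>\<beta>\<in>block_family T l F. \<Sum>u\<in>bits {1..m}. f \<beta> u)"
proof -
  have "(\<Prod>\<beta>\<in>block_family T l F. \<Sum>u\<in>bits {1..m}. f \<beta> u) =
        (\<Sum>u\<in>block_family T l F \<rightarrow>\<^sub>E bits {1..m}. \<Prod>\<beta>\<in>block_family T l F. f \<beta> (u \<beta>))"
    using assms(2) by (intro prod_sum_PiE) (auto simp: finite_bits)
  also have "\<dots> = (\<Sum>x\<in>bits (block_qubits T l F m). \<Prod>\<beta>\<in>block_family T l F.
                     f \<beta> ((\<lambda>\<beta>\<in>block_family T l F. block_bits l m \<beta> x) \<beta>))"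
    by (rule sum.reindex_bij_betw[OF bij_block_bits[OF assms(1)], symmetric])
  finally show ?thesis by (simp cong: prod.cong)
qed

lemma tensor_blocks:
  assumes "l \<in> T" "x \<in> bits (block_qubits T l F m)" "y \<in> bits (block_qubits T l F m)"
  shows "tensor (block_qubits T l F m) G x y =
         (\<Prod>\<beta>\<in>block_family T l F.
            tensor {1..m} (\<lambda>i. G (\<beta>(l := i))) (block_bits l m \<beta> x) (block_bits l m \<beta> y))"
proof -
  have "tensor {1..m} (\<lambda>i. G (\<beta>(l := i))) (block_bits l m \<beta> x) (block_bits l m \<beta> y) =
        (\<Prod>i\<in>{1..m}. G (\<beta>(l := i)) (x (\<beta>(l := i))) (y (\<beta>(l := i))))" for \<beta>
    \<comment> \<open>The membership conditions are discharged first, while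
      \<open>block_bits\<close> is still folded.\<close>
    unfolding tensor_def by (simp only: block_bits_in_bits) (simp add: block_bits_def)
  then show ?thesis
    using assms(2,3) by (simp only: tensor_def prod_block_qubits[OF assms(1)] simp_thms if_True)
qed

text \<open>All blocks share the encoding \<open>V\<close>, while the gates may differ between
  blocks. Both operator products factor into matrix entries of single blocks, so the relations of
  the blocks can be multiplied.\<close>

lemma acts_as_blocks:
  assumes l: "l \<in> T" and fin: "finite (block_family T l F)"
    and act: "\<And>\<beta>. \<beta> \<in> block_family T l F \<Longrightarrow>
      acts_as {1..n} {1..k} V (tensor {1..n} (\<lambda>i. G (\<beta>(l := i)))) (tensor {1..k} (\<lambda>j. G' (\<beta>(l := j))))"
  shows "acts_as (block_qubits T l F n) (block_qubits T l F k)
    (\<lambda>x y. \<Prod>\<beta>\<in>block_family T l F. V (block_bits l n \<beta> x) (block_bits l k \<beta> y))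
    (tensor (block_qubits T l F n) G) (tensor (block_qubits T l F k) G')"
    (is "acts_as ?Q ?P ?W _ _")
proof -
  let ?B = "block_family T l F"
  let ?A = "\<lambda>\<beta>. tensor {1..n} (\<lambda>i. G (\<beta>(l := i)))"
  let ?U = "\<lambda>\<beta>. tensor {1..k} (\<lambda>j. G' (\<beta>(l := j)))"
  have "\<forall>\<beta>\<in>?B. \<exists>c. cmod c = 1 \<and> op_eq {1..n} {1..k} (op_mult {1..n} (?A \<beta>) V)
            (\<lambda>x y. c * op_mult {1..k} V (?U \<beta>) x y)"
    using act unfolding acts_as_def op_eq_phase_def by blast
  \<comment> \<open>Each block contributes its own phase; the phase of the whole level will be
    \<open>prod c ?B\<close>.\<close>
  then obtain c where c: "\<And>\<beta>. \<beta> \<in> ?B \<Longrightarrow> cmod (c \<beta>) = 1"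
    "\<And>\<beta> x y. \<beta> \<in> ?B \<Longrightarrow> x \<in> bits {1..n} \<Longrightarrow> y \<in> bits {1..k} \<Longrightarrow>
       op_mult {1..n} (?A \<beta>) V x y = c \<beta> * op_mult {1..k} V (?U \<beta>) x y"
    unfolding op_eq_def by metis
  have "op_mult ?Q (tensor ?Q G) ?W x z = prod c ?B * op_mult ?P ?W (tensor ?P G') x z"
    if x: "x \<in> bits ?Q" and z: "z \<in> bits ?P" for x z
  proof -
    have "op_mult ?Q (tensor ?Q G) ?W x z =
        (\<Sum>y\<in>bits ?Q. \<Prod>\<beta>\<in>?B. ?A \<beta> (block_bits l n \<beta> x) (block_bits l n \<beta> y) *
            V (block_bits l n \<beta> y) (block_bits l k \<beta> z))"
      unfolding op_mult_def
      by (intro sum.cong) (simp_all add: tensor_blocks[OF l x] prod.distrib)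
    also have "\<dots> = (\<Prod>\<beta>\<in>?B. op_mult {1..n} (?A \<beta>) V (block_bits l n \<beta> x) (block_bits l k \<beta> z))"
      unfolding op_mult_def by (rule sum_bits_blocks[OF l fin])
    also have "\<dots> = prod c ?B *
        (\<Prod>\<beta>\<in>?B. op_mult {1..k} V (?U \<beta>) (block_bits l n \<beta> x) (block_bits l k \<beta> z))"
      unfolding prod.distrib[symmetric] by (intro prod.cong refl c(2) block_bits_in_bits)
    \<comment> \<open>The factorisation is now run backwards on the logical side, with the summation
      over \<open>bits ?P\<close> in place of \<open>bits ?Q\<close>.\<close>
    also have "(\<Prod>\<beta>\<in>?B. op_mult {1..k} V (?U \<beta>) (block_bits l n \<beta> x) (block_bits l k \<beta> z)) =
        (\<Sum>y\<in>bits ?P. \<Prod>\<beta>\<in>?B. V (block_bits l n \<beta> x) (block_bits l k \<beta> y) *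
            ?U \<beta> (block_bits l k \<beta> y) (block_bits l k \<beta> z))"
      unfolding op_mult_def by (rule sum_bits_blocks[OF l fin, symmetric])
    also have "\<dots> = op_mult ?P ?W (tensor ?P G') x z"
      unfolding op_mult_def
      by (intro sum.cong) (simp_all add: tensor_blocks[OF l _ z] prod.distrib)
    finally show ?thesis .
  qed
  moreover have "cmod (prod c ?B) = 1"
    by (simp add: c(1) flip: prod_norm cong: prod.cong)
  ultimately show ?thesis
    unfolding acts_as_def op_eq_phase_def op_eq_def by blast
qed

section \<open>The levels of the concatenated code as instances of blocks\<close>

lemma level_blocks_eq:
  "level_blocks L n k l = block_family {1..L} l (\<lambda>t. if t < l then {1..k t} else {1..n t})"
  by (simp add: level_blocks_def block_family_def)

text \<open>The qubits of a level have two readings: here as logical qubits of the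
  \<open>l\<close>-th code, and in \<open>level_qubits_eq_lower\<close> as physical qubits of the
  next code, which shifts the distinguished coordinate to \<open>Suc l\<close>.\<close>

lemma level_qubits_eq_upper:
  "level_qubits L n k l = block_qubits {1..L} l (\<lambda>t. if t < l then {1..k t} else {1..n t}) (k l)"
  unfolding level_qubits_def block_qubits_def by (intro PiE_cong) auto

lemma level_qubits_eq_lower:
  "level_qubits L n k l =
   block_qubits {1..L} (Suc l) (\<lambda>t. if t < Suc l then {1..k t} else {1..n t}) (n (Suc l))"
  unfolding level_qubits_def block_qubits_def by (intro PiE_cong) auto

lemma finite_level_qubits: "finite (level_qubits L n k l)"
  unfolding level_qubits_def by (intro finite_PiE) auto

lemma finite_level_blocks: "finite (level_blocks L n k l)"
  unfolding level_blocks_def by (intro finite_PiE) auto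

lemma acts_as_level_encoding:
  assumes "Suc l \<le> L"
    and "\<And>\<beta>. \<beta> \<in> level_blocks L n k (Suc l) \<Longrightarrow>
      acts_as {1..n (Suc l)} {1..k (Suc l)} (V (Suc l))
        (tensor {1..n (Suc l)} (\<lambda>i. G (\<beta>(Suc l := i))))
        (tensor {1..k (Suc l)} (\<lambda>j. G' (\<beta>(Suc l := j))))"
  shows "acts_as (level_qubits L n k l) (level_qubits L n k (Suc l))
    (level_encoding L n k V (Suc l))
    (tensor (level_qubits L n k l) G) (tensor (level_qubits L n k (Suc l)) G')"
  unfolding level_encoding_def level_qubits_eq_upper[of L n k "Suc l"]
    level_qubits_eq_lower[of L n k l] level_blocks_eq
proof (rule acts_as_blocks)
  show "Suc l \<in> {1..L}" using assms(1) by simp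
qed (use assms(2) finite_level_blocks in \<open>simp_all only: level_blocks_eq\<close>)

section \<open>Composition along the levels\<close>

lemma implements_refl:
  assumes "l \<le> L"
  shows "implements L n k V l l A A"
proof -
  \<comment> \<open>At 0 this is the base clause; at a successor it is the branch for
    \<open>Suc l \<le> m\<close>.\<close>
  have "concat_encoding L n k V l l = (\<lambda>x y. if x = y then 1 else 0)"
    by (cases l) auto
  then show ?thesis
    using assms acts_as_identity[OF finite_level_qubits] by (simp add: implements_def)
qed

text \<open>The first premise contains \<open>m \<le> l\<close>, so the recursion of
  \<open>concat_encoding\<close> takes its product branch and \<open>acts_as_compose\<close>
  applies.\<close>

lemma implements_Suc:
  assumes "implements L n k V m l A U" "Suc l \<le> L"
    and "acts_as (level_qubits L n k l) (level_qubits L n k (Suc l))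
           (level_encoding L n k V (Suc l)) U T"
  shows "implements L n k V m (Suc l) A T"
  using assms acts_as_compose[OF _ assms(3)] by (auto simp: implements_def)

lemma implements_H_all:
  assumes "\<And>l. l \<in> {1..L} \<Longrightarrow>
      acts_as {1..n l} {1..k l} (V l) (tensor {1..n l} (\<lambda>_. gate_H)) (tensor {1..k l} (\<lambda>_. gate_H))"
    and "m \<le> l" "l \<le> L"
  shows "implements L n k V m l (H_all L n k m) (H_all L n k l)"
  using assms(2,3)
\<comment> \<open>The lower level \<open>m\<close> is fixed and the logical level \<open>l\<close>
  climbs from \<open>m\<close>.\<close>
proof (induction l rule: dec_induct)
  case base
  then show ?case by (rule implements_refl)
next
  case (step l)
  then have "acts_as (level_qubits L n k l) (level_qubits L n k (Suc l))
      (level_encoding L n k V (Suc l)) (H_all L n k l) (H_all L n k (Suc l))"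
    unfolding H_all_def by (intro acts_as_level_encoding assms) auto
  with step show ?case by (intro implements_Suc) auto
qed

text \<open>Compatibility supplies signs one level down for any given signs, but these depend on the
  block and differ from the original ones. Hence the induction generalises over
  \<open>a\<close>.\<close>

lemma implements_S_all:
  assumes "\<And>l (a :: nat \<Rightarrow> int). l \<in> {1..L} \<Longrightarrow> \<forall>j\<in>{1..k l}. a j \<in> {- 1, 1} \<Longrightarrow>
      \<exists>b :: nat \<Rightarrow> int. (\<forall>i\<in>{1..n l}. b i \<in> {- 1, 1}) \<and>
        acts_as {1..n l} {1..k l} (V l) (tensor {1..n l} (\<lambda>i. gate_S_power (b i)))
          (tensor {1..k l} (\<lambda>j. gate_S_power (a j)))"
    and "m \<le> l" "l \<le> L" "\<forall>q\<in>level_qubits L n k l. a q \<in> {- 1, 1}"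
  shows "\<exists>b. (\<forall>q\<in>level_qubits L n k m. b q \<in> {- 1, 1}) \<and>
    implements L n k V m l (S_all L n k m b) (S_all L n k l a)"
  using assms(2-)
proof (induction l arbitrary: a rule: dec_induct)
  case base
  then show ?case using implements_refl by blast
next
  case (step l)
  have SL: "Suc l \<in> {1..L}" using step by simp
  let ?B = "level_blocks L n k (Suc l)"
  have "\<forall>\<beta>\<in>?B. \<exists>b :: nat \<Rightarrow> int. (\<forall>i\<in>{1..n (Suc l)}. b i \<in> {- 1, 1}) \<and>
        acts_as {1..n (Suc l)} {1..k (Suc l)} (V (Suc l))
          (tensor {1..n (Suc l)} (\<lambda>i. gate_S_power (b i)))
          (tensor {1..k (Suc l)} (\<lambda>j. gate_S_power (a (\<beta>(Suc l := j)))))"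
  proof
    fix \<beta> assume "\<beta> \<in> ?B"
    then have "\<beta>(Suc l := j) \<in> level_qubits L n k (Suc l)" if "j \<in> {1..k (Suc l)}" for j
      using that SL block_qubits_upd unfolding level_blocks_eq level_qubits_eq_upper by blast
    then show "\<exists>b :: nat \<Rightarrow> int. (\<forall>i\<in>{1..n (Suc l)}. b i \<in> {- 1, 1}) \<and>
        acts_as {1..n (Suc l)} {1..k (Suc l)} (V (Suc l))
          (tensor {1..n (Suc l)} (\<lambda>i. gate_S_power (b i)))
          (tensor {1..k (Suc l)} (\<lambda>j. gate_S_power (a (\<beta>(Suc l := j)))))"
      using step.prems by (intro assms(1)[OF SL]) blast
  qed
  \<comment> \<open>Choice over the blocks: \<open>b \<beta>\<close> is the sign vector answering
    the restriction of \<open>a\<close> to block \<open>\<beta>\<close>.\<close>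
  then obtain b where b: "\<And>\<beta> i. \<beta> \<in> ?B \<Longrightarrow> i \<in> {1..n (Suc l)} \<Longrightarrow> (b \<beta> i :: int) \<in> {- 1, 1}"
    and act: "\<And>\<beta>. \<beta> \<in> ?B \<Longrightarrow> acts_as {1..n (Suc l)} {1..k (Suc l)} (V (Suc l))
          (tensor {1..n (Suc l)} (\<lambda>i. gate_S_power (b \<beta> i)))
          (tensor {1..k (Suc l)} (\<lambda>j. gate_S_power (a (\<beta>(Suc l := j)))))"
    by metis
  \<comment> \<open>The sign vectors of the blocks are glued into one sign function on the
    level-\<open>l\<close> qubits.\<close>
  define b' where "b' q = b (q(Suc l := undefined)) (q (Suc l))" for q
  have b'_upd: "b' (\<beta>(Suc l := i)) = b \<beta> i" if "\<beta> \<in> ?B" for \<beta> i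
  proof -
    have "\<beta> (Suc l) = undefined"
      using that unfolding level_blocks_eq by (rule block_family_undefined)
    then show ?thesis by (simp add: b'_def fun_upd_idem)
  qed
  have "\<forall>q\<in>level_qubits L n k l. b' q \<in> {- 1, 1}"
  proof
    fix q assume "q \<in> level_qubits L n k l"
    note q = block_qubits_restrict[OF SL this[unfolded level_qubits_eq_lower], folded level_blocks_eq]
    show "b' q \<in> {- 1, 1}" unfolding b'_def by (rule b[OF q])
  qed
  moreover have "l \<le> L" using SL by simp
  \<comment> \<open>The induction hypothesis is used for the signs \<open>b'\<close> instead of
    \<open>a\<close>.\<close>
  ultimately obtain b0 where b0: "\<forall>q\<in>level_qubits L n k m. b0 q \<in> {- 1, 1}"
    "implements L n k V m l (S_all L n k m b0) (S_all L n k l b')"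
    using step.IH by blast
  have "acts_as (level_qubits L n k l) (level_qubits L n k (Suc l))
      (level_encoding L n k V (Suc l)) (S_all L n k l b') (S_all L n k (Suc l) a)"
    unfolding S_all_def
  proof (rule acts_as_level_encoding)
    show "Suc l \<le> L" using SL by simp
  qed (simp only: b'_upd act)
  then have "implements L n k V m (Suc l) (S_all L n k m b0) (S_all L n k (Suc l) a)"
    using b0(2) SL by (intro implements_Suc) auto
  with b0(1) show ?case by blast
qed

section \<open>Unitarity of the gates and the final assembly\<close>

lemma sum_UNIV_bit: "(\<Sum>c\<in>UNIV. f c) = f (0 :: bit) + f 1"
  by (simp add: UNIV_bit)

lemma unitary_gate_H: "unitary_gate gate_H"
proof -
  have "complex_of_real (sqrt 2) * complex_of_real (sqrt 2) = 2"
    by (simp flip: of_real_mult)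
  then show ?thesis
    by (auto simp: unitary_gate_def sum_UNIV_bit gate_H_def field_simps)
qed

lemma unitary_gate_S_power: "s \<in> {- 1, 1} \<Longrightarrow> unitary_gate (gate_S_power s)"
  by (auto simp: unitary_gate_def sum_UNIV_bit gate_S_power_def power_int_minus)

theorem corollary2:
  fixes L N K Dist :: nat
    and n k d r :: "nat \<Rightarrow> nat"
    and D :: "nat \<Rightarrow> (nat \<Rightarrow> bit) set"
    and g h :: "nat \<Rightarrow> nat \<Rightarrow> nat \<Rightarrow> bit"
    and XB ZB :: "nat \<Rightarrow> nat \<Rightarrow> (nat, nat) op"
    and V :: "nat \<Rightarrow> (nat, nat) op"
  assumes "1 \<le> L"
    and "\<And>l. l \<in> {1..L} \<Longrightarrow> self_dual_css_code (n l) (k l) (d l) (D l) (r l) (g l)"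
    and "\<And>l. l \<in> {1..L} \<Longrightarrow> 1 \<le> k l"
    and "\<And>l. l \<in> {1..L} \<Longrightarrow> dual_code {1..n l} (D l) \<subset> D l"
    and "\<And>l. l \<in> {1..L} \<Longrightarrow> D l = bitvec.span (dual_code {1..n l} (D l) \<union> h l ` {1..k l})"
    and "\<And>l. l \<in> {1..L} \<Longrightarrow> \<exists>j\<in>{1..k l}. dot {1..n l} (h l j) (h l j) = 1"
    and "\<And>l. l \<in> {1..L} \<Longrightarrow>
           compatible_basis (n l) (k l) (css_stabilizer (n l) (r l) (g l)) (XB l) (ZB l)"
    and "\<And>l. l \<in> {1..L} \<Longrightarrow>
           is_encoding (n l) (k l) (css_stabilizer (n l) (r l) (g l)) (XB l) (ZB l) (V l)"
    and "concat_parameters L n k V N K Dist"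
  shows "((\<forall>m\<in>{0..L}. transversal_at L n k V L m (H_all L n k L)) \<and>
          implements L n k V 0 L (H_all L n k 0) (H_all L n k L)) \<and>
         (\<forall>a :: (nat \<Rightarrow> nat) \<Rightarrow> int. (\<forall>q\<in>level_qubits L n k L. a q \<in> {1, - 1}) \<longrightarrow>
            (\<forall>m\<in>{0..L}. transversal_at L n k V L m (S_all L n k L a)) \<and>
            (\<exists>b :: (nat \<Rightarrow> nat) \<Rightarrow> int. (\<forall>q\<in>level_qubits L n k 0. b q \<in> {- 1, 1}) \<and>
               implements L n k V 0 L (S_all L n k 0 b) (S_all L n k L a)))"
proof -
  \<comment> \<open>Compatibility speaks about every encoding for the basis; it is specialised to
    the given \<open>V l\<close>.\<close>
  have compat:
    "acts_as {1..n l} {1..k l} (V l) (tensor {1..n l} (\<lambda>_. gate_H)) (tensor {1..k l} (\<lambda>_. gate_H))"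
    "\<forall>a :: nat \<Rightarrow> int. (\<forall>j\<in>{1..k l}. a j \<in> {- 1, 1}) \<longrightarrow>
       (\<exists>b :: nat \<Rightarrow> int. (\<forall>i\<in>{1..n l}. b i \<in> {- 1, 1}) \<and>
          acts_as {1..n l} {1..k l} (V l) (tensor {1..n l} (\<lambda>i. gate_S_power (b i)))
            (tensor {1..k l} (\<lambda>j. gate_S_power (a j))))"
    if "l \<in> {1..L}" for l
    using assms(7,8)[OF that] unfolding compatible_basis_def by blast+
  have H: "implements L n k V m L (H_all L n k m) (H_all L n k L)" if "m \<le> L" for m
    using compat(1) that by (intro implements_H_all) auto
  have S: "\<exists>b. (\<forall>q\<in>level_qubits L n k m. b q \<in> {- 1, 1}) \<and>
      implements L n k V m L (S_all L n k m b) (S_all L n k L a)"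
    if "m \<le> L" "\<forall>q\<in>level_qubits L n k L. a q \<in> {1, - 1}" for m a
    using compat(2) that by (intro implements_S_all) auto
  \<comment> \<open>Transversality at level \<open>m\<close> is witnessed by the implementing
    operator itself, a tensor product of unitary gates.\<close>
  have "transversal_at L n k V L m (H_all L n k L)" if "m \<le> L" for m
    using H[OF that] unitary_gate_H unfolding transversal_at_def H_all_def[of L n k m]
    by (intro exI[of _ "\<lambda>_. gate_H"]) blast
  moreover have "transversal_at L n k V L m (S_all L n k L a)"
    if "m \<le> L" "\<forall>q\<in>level_qubits L n k L. a q \<in> {1, - 1}" for m a
  proof -
    from S[OF that] obtain b where "\<forall>q\<in>level_qubits L n k m. b q \<in> {- 1, 1}"
      "implements L n k V m L (S_all L n k m b) (S_all L n k L a)"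
      by blast
    then show ?thesis
      using unitary_gate_S_power unfolding transversal_at_def S_all_def[of L n k m]
      by (intro exI[of _ "\<lambda>q. gate_S_power (b q)"]) blast
  qed
  \<comment> \<open>The implementations on physical qubits are the instances \<open>m = 0\<close> of
    \<open>H\<close> and \<open>S\<close>.\<close>
  ultimately show ?thesis using H S by simp
qed

end
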